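(* Let $n\in\mathbb{N}$, let $s=(s_\alpha)_{\alpha\in\mathbb{N}_0^n}\in\mathbb{C}^{\mathbb{N}_0^n}$ be a complex sequence, and let $g:\mathbb{R}^n\to\mathbb{R}$ be a measurable function such that \[\int_{\mathbb{R}^n} g(x)\,\mathrm{d}x\neq 0\qquad\text{and}\qquad \int_{\mathbb{R}^n}|x^\alpha\cdot g(x)|\,\mathrm{d}x<\infty\] for all $\alpha\in\mathbb{N}_0^n$. Let $K$ be a countable set of points in $\mathbb{R}^n$ such that $K$ is Zariski dense and $\dim\mathcal{N}_d(K)<\infty$ for all $d\in\mathbb{N}_0$. Then, for all $y\in K$, there exist coefficients $c_y\in\mathbb{C}$ such that \[f(x):=\sum_{y\in K}c_y\cdot g(x-y)\] is measurable with \[s_\alpha=\int_{\mathbb{R}^n}x^\alpha\cdot f(x)\,\mathrm{d}x\qquad\text{and}\qquad\int_{\mathbb{R}^n}|x^\alpha\cdot f(x)|\,\mathrm{d}x<\infty\] for all $\alpha\in\mathbb{N}_0^n$.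
   Context: Here $\mathbb{N}=\{1,2,\dots\}$, $\mathbb{N}_0=\{0,1,2,\dots\}$, and for $\alpha=(\alpha_1,\dots,\alpha_n)\in\mathbb{N}_0^n$ one writes $x^\alpha=x_1^{\alpha_1}\cdots x_n^{\alpha_n}$. Integrals are with respect to Lebesgue measure on $\mathbb{R}^n$, and $|x|$ is the Euclidean norm. For $K\subseteq\mathbb{R}^n$ and $d\in\mathbb{N}_0$, define the real vector space \[\mathcal{N}_d(K):=\left\{p\in\mathbb{R}[x_1,\dots,x_n]\ \middle|\ \sup_{x\in K}\frac{|p(x)|}{(1+|x|^2)^d}<\infty\right\}.\] A set $K\subseteq\mathbb{R}^n$ is Zariski dense if the only polynomial in $\mathbb{R}[x_1,\dots,x_n]$ vanishing at every point of $K$ is the zero polynomial. *)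

theory Defs
  imports
    "HOL-Analysis.Analysis"
    "HOL-Analysis.Finite_Function_Topology"
begin

text \<open>
  The dimension \<open>n\<close> is \<open>CARD('n)\<close> for a finite (hence nonempty) index type \<open>'n\<close>. Multi-indices are
  elements of \<open>nat ^ 'n\<close>. A real polynomial in \<open>n\<close> variables is an element of the monoid algebra
  of \<open>nat ^ 'n\<close>, i.e. a finitely supported coefficient family. The theory
  \<open>Finite_Function_Topology\<close> is imported for its \<open>real_vector\<close> instance of \<open>poly_mapping\<close>
  (coefficientwise operations); the topology it also introduces plays no role.
\<close>

type_synonym 'n real_mpoly = "(nat ^ 'n) \<Rightarrow>\<^sub>0 real"

definition vpow :: "real ^ 'n \<Rightarrow> nat ^ 'n \<Rightarrow> real" where
  "vpow x \<alpha> = (\<Prod>i\<in>UNIV. (x $ i) ^ (\<alpha> $ i))"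

definition mpeval :: "'n::finite real_mpoly \<Rightarrow> real ^ 'n \<Rightarrow> real" where
  "mpeval p x = (\<Sum>\<alpha>\<in>Poly_Mapping.keys p. Poly_Mapping.lookup p \<alpha> * vpow x \<alpha>)"

definition growth_space :: "nat \<Rightarrow> (real ^ 'n) set \<Rightarrow> 'n::finite real_mpoly set" where
  "growth_space d K = {p. bdd_above ((\<lambda>x. \<bar>mpeval p x\<bar> / (1 + (norm x)\<^sup>2) ^ d) ` K)}"

definition zariski_dense :: "(real ^ 'n::finite) set \<Rightarrow> bool" where
  "zariski_dense K \<longleftrightarrow> (\<forall>p :: 'n real_mpoly. (\<forall>x\<in>K. mpeval p x = 0) \<longrightarrow> p = 0)"

text \<open>
  Finite dimensionality is stated by a finite spanning set, since the library's \<open>dim\<close> takes the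
  value 0 on infinite-dimensional spaces.
\<close>

definition finite_dim :: "'a::real_vector set \<Rightarrow> bool" where
  "finite_dim V \<longleftrightarrow> (\<exists>B. finite B \<and> span B = V)"

lemma lookup_scaleR_poly_mapping:
  fixes p :: "'a \<Rightarrow>\<^sub>0 'b::real_vector"
  shows "Poly_Mapping.lookup (r *\<^sub>R p) k = r *\<^sub>R Poly_Mapping.lookup p k"
proof -
  have "finite {i. r *\<^sub>R Poly_Mapping.lookup p i \<noteq> 0}"
    by (rule finite_subset[OF _ finite_keys[of p]]) (auto simp: in_keys_iff)
  then show ?thesis by (simp add: scaleR_poly_mapping_def)
qed

lemma mpeval_superset:
  assumes "finite S" "Poly_Mapping.keys p \<subseteq> S"
  shows "mpeval p x = (\<Sum>\<alpha>\<in>S. Poly_Mapping.lookup p \<alpha> * vpow x \<alpha>)"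
  unfolding mpeval_def
  by (rule sum.mono_neutral_left) (use assms in \<open>auto simp: in_keys_iff\<close>)

lemma mpeval_0 [simp]: "mpeval 0 x = 0"
  by (simp add: mpeval_def)

lemma mpeval_add: "mpeval (p + q) x = mpeval p x + mpeval q x"
proof -
  let ?S = "Poly_Mapping.keys p \<union> Poly_Mapping.keys q"
  have "mpeval (p + q) x = (\<Sum>\<alpha>\<in>?S. Poly_Mapping.lookup (p + q) \<alpha> * vpow x \<alpha>)"
    by (rule mpeval_superset) (use keys_add[of p q] in auto)
  also have "\<dots> = (\<Sum>\<alpha>\<in>?S. Poly_Mapping.lookup p \<alpha> * vpow x \<alpha>) +
      (\<Sum>\<alpha>\<in>?S. Poly_Mapping.lookup q \<alpha> * vpow x \<alpha>)"
    by (simp add: lookup_add distrib_right sum.distrib)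
  also have "\<dots> = mpeval p x + mpeval q x"
    by (subst (1 2) mpeval_superset[where S = ?S]) auto
  finally show ?thesis .
qed

lemma mpeval_scaleR: "mpeval (r *\<^sub>R p) x = r * mpeval p x"
proof -
  have "mpeval (r *\<^sub>R p) x = (\<Sum>\<alpha>\<in>Poly_Mapping.keys p. Poly_Mapping.lookup (r *\<^sub>R p) \<alpha> * vpow x \<alpha>)"
    by (rule mpeval_superset) (auto simp: in_keys_iff lookup_scaleR_poly_mapping)
  then show ?thesis
    by (simp add: lookup_scaleR_poly_mapping mpeval_def sum_distrib_left mult.assoc)
qed

lemma subspace_growth_space: "subspace (growth_space d K)"
proof (rule subspaceI)
  show "0 \<in> growth_space d K"
    by (auto simp: growth_space_def bdd_above_def)
next
  fix p q :: "'a real_mpoly"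
  assume "p \<in> growth_space d K" "q \<in> growth_space d K"
  then obtain A B where
    A: "\<And>x. x \<in> K \<Longrightarrow> \<bar>mpeval p x\<bar> / (1 + (norm x)\<^sup>2) ^ d \<le> A" and
    B: "\<And>x. x \<in> K \<Longrightarrow> \<bar>mpeval q x\<bar> / (1 + (norm x)\<^sup>2) ^ d \<le> B"
    by (auto simp: growth_space_def bdd_above_def)
  have "\<bar>mpeval (p + q) x\<bar> / (1 + (norm x)\<^sup>2) ^ d \<le> A + B" if "x \<in> K" for x
  proof -
    have "\<bar>mpeval (p + q) x\<bar> / (1 + (norm x)\<^sup>2) ^ d
        \<le> (\<bar>mpeval p x\<bar> + \<bar>mpeval q x\<bar>) / (1 + (norm x)\<^sup>2) ^ d"
      by (intro divide_right_mono) (auto simp: mpeval_add)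
    also have "\<dots> \<le> A + B"
      using A[OF that] B[OF that] by (simp add: add_divide_distrib)
    finally show ?thesis .
  qed
  then show "p + q \<in> growth_space d K"
    by (auto simp: growth_space_def bdd_above_def)
next
  fix r :: real and p :: "'a real_mpoly"
  assume "p \<in> growth_space d K"
  then obtain A where A: "\<And>x. x \<in> K \<Longrightarrow> \<bar>mpeval p x\<bar> / (1 + (norm x)\<^sup>2) ^ d \<le> A"
    by (auto simp: growth_space_def bdd_above_def)
  have "\<bar>mpeval (r *\<^sub>R p) x\<bar> / (1 + (norm x)\<^sup>2) ^ d \<le> \<bar>r\<bar> * A" if "x \<in> K" for x
    using mult_left_mono[OF A[OF that], of "\<bar>r\<bar>"] by (simp add: mpeval_scaleR abs_mult)
  then show "r *\<^sub>R p \<in> growth_space d K"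
    by (auto simp: growth_space_def bdd_above_def)
qed

text \<open>
  For measurable \<open>g\<close> the series over \<open>K\<close> can in general only converge almost everywhere (changing
  \<open>g\<close> on a null set may destroy convergence at some points). \<open>shift_sum\<close> is the value of the
  unconditional (equivalently, absolute) sum where it exists, and 0 elsewhere; a statement using it
  has to assert convergence almost everywhere separately.
\<close>

definition shift_sum ::
  "(real ^ 'n \<Rightarrow> complex) \<Rightarrow> (real ^ 'n) set \<Rightarrow> (real ^ 'n \<Rightarrow> real) \<Rightarrow> real ^ 'n::finite \<Rightarrow> complex" where
  "shift_sum c K g x = (\<Sum>\<^sub>\<infinity>y\<in>K. c y * complex_of_real (g (x - y)))"

end

theory Submission
  imports Defs
begin

text \<open>
  By translation, the \<open>\<alpha>\<close>-moment of \<open>g(x - y)\<close> is a polynomial in \<open>y\<close> with top term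
  \<open>(\<integral>g) y\<^sup>\<alpha>\<close>, so a triangular change of variables turns the claim into a moment problem on \<open>K\<close>:
  find a rapidly decreasing family \<open>c\<close> with \<open>\<Sum>\<^sub>y c\<^sub>y y\<^sup>\<alpha> = t\<^sub>\<alpha>\<close> for all \<open>\<alpha>\<close>. This is solved as in
  Eidelheit's theorem. Since the polynomials bounded on \<open>K\<close> by the \<open>d\<close>-th weight form a
  finite-dimensional space \<open>N\<^sub>d\<close>, a Hahn-Banach argument in finite codimension shows that prescribed
  values on \<open>N\<^sub>d\<^sub>+\<^sub>1\<close> that vanish on \<open>N\<^sub>d\<close> are attained by finitely supported families of arbitrarily
  small \<open>d\<close>-th weighted norm. Correcting successively on \<open>N\<^sub>0, N\<^sub>1, \<dots>\<close> by families of norm at most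
  \<open>2\<^sup>-\<^sup>d\<close> gives a convergent series.
\<close>

subsection \<open>Hahn-Banach extension in finite codimension\<close>

text \<open>On the affine slice \<open>q c = 1\<close> the claim reads \<open>p c - M * N c\<close>
  \<le> \<open>a\<close> \<le> \<open>p c + M * N c\<close>. Every lower bound lies below every
  upper bound because the difference of two slice points is in the kernel of \<open>q\<close>, where
  \<open>bd\<close> applies. Rescaling then covers all \<open>c\<close> with \<open>q c\<close>
  nonzero.\<close>

lemma seminorm_extension_step:
  fixes N p q :: "'a::real_vector \<Rightarrow> real"
  assumes S: "subspace S" and p: "linear p" and q: "linear q"
    and tri: "\<And>a b. N (a - b) \<le> N a + N b"
    and hom: "\<And>r a. N (r *\<^sub>R a) = \<bar>r\<bar> * N a"
    and M: "0 \<le> M"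
    and bd: "\<And>c. c \<in> S \<Longrightarrow> q c = 0 \<Longrightarrow> \<bar>p c\<bar> \<le> M * N c"
  shows "\<exists>a. \<forall>c\<in>S. \<bar>p c - a * q c\<bar> \<le> M * N c"
proof (cases "\<exists>c\<in>S. q c \<noteq> 0")
  case False
  then show ?thesis using bd by (intro exI[of _ 0]) auto
next
  case True
  then obtain c0 where c0: "c0 \<in> S" "q c0 \<noteq> 0" by blast
  define H where "H = {c\<in>S. q c = 1}"
  have e0: "(1 / q c0) *\<^sub>R c0 \<in> H"
    using c0 S by (auto simp: H_def linear_scale[OF q] subspace_scale)
  define a where "a = (SUP c\<in>H. p c - M * N c)"
  have cross: "p c - M * N c \<le> p c' + M * N c'" if "c \<in> H" "c' \<in> H" for c c'
  proof -
    have "\<bar>p (c - c')\<bar> \<le> M * N (c - c')"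
      using that S by (intro bd) (auto simp: H_def subspace_diff linear_diff[OF q])
    also have "\<dots> \<le> M * (N c + N c')"
      using tri M by (rule mult_left_mono)
    finally show ?thesis
      by (simp add: linear_diff[OF p] algebra_simps abs_le_iff)
  qed
  have bdd: "bdd_above ((\<lambda>c. p c - M * N c) ` H)"
    using cross[OF _ e0] by (intro bdd_aboveI) auto
  have up: "p c - M * N c \<le> a" if "c \<in> H" for c
    unfolding a_def using bdd that by (rule cSUP_upper2) auto
  have lo: "a \<le> p c + M * N c" if "c \<in> H" for c
    unfolding a_def using e0 cross[OF _ that] by (intro cSUP_least) auto
  have "\<bar>p c - a * q c\<bar> \<le> M * N c" if c: "c \<in> S" for c
  proof (cases "q c = 0")
    case True
    then show ?thesis using bd c by simp
  next
    case False
    let ?e = "(1 / q c) *\<^sub>R c"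
    have e: "?e \<in> H" using c S False
      by (auto simp: H_def linear_scale[OF q] subspace_scale)
    have "\<bar>p ?e - a\<bar> \<le> M * N ?e" using up[OF e] lo[OF e] by (simp add: abs_le_iff)
    then have "\<bar>q c\<bar> * \<bar>p ?e - a\<bar> \<le> \<bar>q c\<bar> * (M * N ?e)"
      by (rule mult_left_mono) simp
    moreover have "\<bar>q c\<bar> * \<bar>p ?e - a\<bar> = \<bar>p c - a * q c\<bar>"
      using False by (simp add: linear_scale[OF p] abs_mult[symmetric] algebra_simps)
    moreover have "\<bar>q c\<bar> * (M * N ?e) = M * N c"
      using False by (simp add: hom)
    ultimately show ?thesis by simp
  qed
  then show ?thesis by blast
qed

lemma seminorm_extension_finite_codim:
  fixes N :: "'a::real_vector \<Rightarrow> real" and \<phi> :: "'b::real_vector \<Rightarrow> 'a \<Rightarrow> real"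
  assumes "finite B"
    and S: "subspace S" and lin1: "\<And>p. linear (\<phi> p)" and lin2: "\<And>c. linear (\<lambda>p. \<phi> p c)"
    and tri: "\<And>a b. N (a - b) \<le> N a + N b"
    and hom: "\<And>r a. N (r *\<^sub>R a) = \<bar>r\<bar> * N a"
    and M: "0 \<le> M"
    and bd: "\<And>c. c \<in> S \<Longrightarrow> (\<And>q. q \<in> B \<Longrightarrow> \<phi> q c = 0) \<Longrightarrow> \<bar>\<phi> p c\<bar> \<le> M * N c"
  shows "\<exists>f\<in>span B. \<forall>c\<in>S. \<bar>\<phi> (p - f) c\<bar> \<le> M * N c"
  using assms(1) bd
proof (induction B arbitrary: p rule: finite_induct)
  case empty
  then show ?case by (intro bexI[of _ 0]) auto
next
  case (insert q B)
  \<comment> \<open>On \<open>S'\<close> the functionals of \<open>B\<close> already vanish, so only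
    the constraint from \<open>q\<close> is left and the one-dimensional step applies.\<close>
  define S' where "S' = {c\<in>S. \<forall>b\<in>B. \<phi> b c = 0}"
  have S': "subspace S'"
    using S by (auto simp: subspace_def S'_def linear_add[OF lin1] linear_scale[OF lin1] linear_0[OF lin1])
  have "\<exists>a. \<forall>c\<in>S'. \<bar>\<phi> p c - a * \<phi> q c\<bar> \<le> M * N c"
    by (rule seminorm_extension_step[OF S' lin1 lin1 tri hom M])
       (use insert.prems in \<open>auto simp: S'_def\<close>)
  then obtain a where a: "\<And>c. c \<in> S' \<Longrightarrow> \<bar>\<phi> p c - a * \<phi> q c\<bar> \<le> M * N c" by blast
  have eq: "\<phi> (p - a *\<^sub>R q) c = \<phi> p c - a * \<phi> q c" for c
    using linear_diff[OF lin2[of c], of p "a *\<^sub>R q"] linear_scale[OF lin2[of c], of a q] by simp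
  have "\<exists>f\<in>span B. \<forall>c\<in>S. \<bar>\<phi> (p - a *\<^sub>R q - f) c\<bar> \<le> M * N c"
    by (rule insert.IH) (use a in \<open>auto simp: eq S'_def\<close>)
  then obtain f where f: "f \<in> span B" "\<And>c. c \<in> S \<Longrightarrow> \<bar>\<phi> (p - a *\<^sub>R q - f) c\<bar> \<le> M * N c"
    by blast
  have "a *\<^sub>R q + f \<in> span (insert q B)"
    using f(1) span_mono[of B "insert q B"]
    by (intro span_add span_scale) (auto intro: span_base)
  then show ?case using f(2) by (intro bexI[of _ "a *\<^sub>R q + f"]) (auto simp: diff_diff_eq)
qed

subsection \<open>Interpolation by weighted summable families\<close>

text \<open>Read \<open>c\<close> as a finitely supported signed measure. The same pairing later
  serves with \<open>c\<close> the coefficient family of a polynomial.\<close>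

definition fin_pairing :: "('y \<Rightarrow>\<^sub>0 real) \<Rightarrow> ('y \<Rightarrow> real) \<Rightarrow> real" where
  "fin_pairing c h = (\<Sum>y\<in>Poly_Mapping.keys c. Poly_Mapping.lookup c y * h y)"

text \<open>The weight may vanish: the zero weight starts the successive interpolation.\<close>

definition weighted_l1 :: "('y \<Rightarrow> real) \<Rightarrow> ('y \<Rightarrow>\<^sub>0 real) \<Rightarrow> real" where
  "weighted_l1 w c = (\<Sum>y\<in>Poly_Mapping.keys c. \<bar>Poly_Mapping.lookup c y\<bar> * w y)"

lemma fin_pairing_superset:
  assumes "finite S" "Poly_Mapping.keys c \<subseteq> S"
  shows "fin_pairing c h = (\<Sum>y\<in>S. Poly_Mapping.lookup c y * h y)"
  unfolding fin_pairing_def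
  by (rule sum.mono_neutral_left) (use assms in \<open>auto simp: in_keys_iff\<close>)

lemma weighted_l1_superset:
  assumes "finite S" "Poly_Mapping.keys c \<subseteq> S"
  shows "weighted_l1 w c = (\<Sum>y\<in>S. \<bar>Poly_Mapping.lookup c y\<bar> * w y)"
  unfolding weighted_l1_def
  by (rule sum.mono_neutral_left) (use assms in \<open>auto simp: in_keys_iff\<close>)

lemma keys_scaleR_subset: "Poly_Mapping.keys (r *\<^sub>R (c :: 'y \<Rightarrow>\<^sub>0 real)) \<subseteq> Poly_Mapping.keys c"
  by (auto simp: in_keys_iff lookup_scaleR_poly_mapping)

lemma linear_fin_pairing: "linear (\<lambda>c. fin_pairing c h)"
proof (rule linearI)
  fix a b :: "'a \<Rightarrow>\<^sub>0 real" and r :: real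
  let ?S = "Poly_Mapping.keys a \<union> Poly_Mapping.keys b"
  have "fin_pairing (a + b) h = (\<Sum>y\<in>?S. Poly_Mapping.lookup (a + b) y * h y)"
    by (rule fin_pairing_superset) (use keys_add[of a b] in auto)
  then show "fin_pairing (a + b) h = fin_pairing a h + fin_pairing b h"
    by (simp add: fin_pairing_superset[of ?S a] fin_pairing_superset[of ?S b] lookup_add
        distrib_right sum.distrib)
  show "fin_pairing (r *\<^sub>R a) h = r *\<^sub>R fin_pairing a h"
    using fin_pairing_superset[OF finite_keys keys_scaleR_subset, of r a h]
    by (simp add: fin_pairing_def lookup_scaleR_poly_mapping sum_distrib_left mult.assoc)
qed

lemma linear_fin_pairing_right:
  assumes "\<And>y. linear (\<lambda>p. ev p y)"
  shows "linear (\<lambda>p. fin_pairing c (ev p))"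
  by (rule linearI) (simp_all add: fin_pairing_def linear_add[OF assms] linear_scale[OF assms]
      distrib_left sum.distrib sum_distrib_left mult.left_commute)

lemma weighted_l1_add:
  assumes "\<And>y. 0 \<le> w y"
  shows "weighted_l1 w (a + b) \<le> weighted_l1 w a + weighted_l1 w b"
proof -
  let ?S = "Poly_Mapping.keys a \<union> Poly_Mapping.keys b"
  have "weighted_l1 w (a + b) = (\<Sum>y\<in>?S. \<bar>Poly_Mapping.lookup (a + b) y\<bar> * w y)"
    by (rule weighted_l1_superset) (use keys_add[of a b] in auto)
  also have "\<dots> \<le> (\<Sum>y\<in>?S. \<bar>Poly_Mapping.lookup a y\<bar> * w y + \<bar>Poly_Mapping.lookup b y\<bar> * w y)"
    using assms by (intro sum_mono) (simp add: lookup_add distrib_right[symmetric] mult_right_mono)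
  finally show ?thesis
    by (simp add: weighted_l1_superset[of ?S a] weighted_l1_superset[of ?S b] sum.distrib)
qed

lemma weighted_l1_scaleR: "weighted_l1 w (r *\<^sub>R a) = \<bar>r\<bar> * weighted_l1 w a"
  using weighted_l1_superset[OF finite_keys keys_scaleR_subset, of w r a]
  by (simp add: weighted_l1_def lookup_scaleR_poly_mapping sum_distrib_left mult.assoc abs_mult)

lemma weighted_l1_nonneg: "(\<And>y. 0 \<le> w y) \<Longrightarrow> 0 \<le> weighted_l1 w a"
  unfolding weighted_l1_def by (intro sum_nonneg) auto

lemma weighted_l1_mono: "(\<And>y. v y \<le> w y) \<Longrightarrow> weighted_l1 v a \<le> weighted_l1 w a"
  unfolding weighted_l1_def by (intro sum_mono mult_left_mono) auto

lemma weighted_l1_diff: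
  assumes "\<And>y. 0 \<le> w y"
  shows "weighted_l1 w (a - b) \<le> weighted_l1 w a + weighted_l1 w b"
  using weighted_l1_add[of w a "(-1) *\<^sub>R b", OF assms] weighted_l1_scaleR[of w "-1" b] by simp

lemma sum_le_weighted_l1:
  assumes "\<And>y. 0 \<le> w y" "finite Y"
  shows "(\<Sum>y\<in>Y. \<bar>Poly_Mapping.lookup c y\<bar> * w y) \<le> weighted_l1 w c"
proof -
  have "(\<Sum>y\<in>Y. \<bar>Poly_Mapping.lookup c y\<bar> * w y)
      \<le> (\<Sum>y\<in>Y \<union> Poly_Mapping.keys c. \<bar>Poly_Mapping.lookup c y\<bar> * w y)"
    using assms by (intro sum_mono2) auto
  then show ?thesis using assms by (simp add: weighted_l1_superset[of "Y \<union> Poly_Mapping.keys c"])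
qed

section \<open>Duality: small families with prescribed pairings\<close>

lemma subspace_supported_on: "subspace {c :: 'y \<Rightarrow>\<^sub>0 real. Poly_Mapping.keys c \<subseteq> K}"
proof (rule subspaceI)
  fix a b :: "'y \<Rightarrow>\<^sub>0 real" and r :: real
  assume a: "a \<in> {c. Poly_Mapping.keys c \<subseteq> K}"
  then show "r *\<^sub>R a \<in> {c. Poly_Mapping.keys c \<subseteq> K}"
    using keys_scaleR_subset[of r a] by auto
  assume "b \<in> {c. Poly_Mapping.keys c \<subseteq> K}"
  with a show "a + b \<in> {c. Poly_Mapping.keys c \<subseteq> K}"
    using keys_add[of a b] by auto
qed simp

text \<open>If no such \<open>c\<close> existed, scaling would bound the pairing with
  \<open>p\<close> by \<open>1 / \<epsilon>\<close> times the norm on the annihilator of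
  \<open>B\<close>. The extension lemma moves this bound to some \<open>p - f\<close> with
  \<open>f\<close> in \<open>span B\<close>; then \<open>p - f\<close> is bounded by the weight,
  hence lies in \<open>span B\<close>, and so does \<open>p\<close>.\<close>

lemma small_annihilator:
  fixes ev :: "'b::real_vector \<Rightarrow> 'y \<Rightarrow> real"
  assumes ev: "\<And>y. linear (\<lambda>p. ev p y)" and w: "\<And>y. 0 \<le> w y"
    and B: "finite B" "\<And>p M. (\<And>y. y \<in> K \<Longrightarrow> \<bar>ev p y\<bar> \<le> M * w y) \<Longrightarrow> p \<in> span B"
    and p: "p \<notin> span B" and \<epsilon>: "0 < \<epsilon>"
  shows "\<exists>c. Poly_Mapping.keys c \<subseteq> K \<and> (\<forall>q\<in>span B. fin_pairing c (ev q) = 0) \<and>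
    fin_pairing c (ev p) = 1 \<and> weighted_l1 w c \<le> \<epsilon>"
proof (rule ccontr)
  assume neg: "\<not> ?thesis"
  let ?S = "{c :: 'y \<Rightarrow>\<^sub>0 real. Poly_Mapping.keys c \<subseteq> K}"
  note lin1 = linear_fin_pairing and lin2 = linear_fin_pairing_right[OF ev]
  have "\<exists>f\<in>span B. \<forall>c\<in>?S. \<bar>fin_pairing c (ev (p - f))\<bar> \<le> (1 / \<epsilon>) * weighted_l1 w c"
  proof (rule seminorm_extension_finite_codim[OF B(1) subspace_supported_on lin1 lin2
        weighted_l1_diff[OF w] weighted_l1_scaleR])
    fix c :: "'y \<Rightarrow>\<^sub>0 real"
    assume c: "c \<in> ?S" "\<And>q. q \<in> B \<Longrightarrow> fin_pairing c (ev q) = 0"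
    have z: "fin_pairing c (ev q) = 0" if "q \<in> span B" for q
      using linear_eq_0_on_span[OF lin2 c(2) that] .
    show "\<bar>fin_pairing c (ev p)\<bar> \<le> (1 / \<epsilon>) * weighted_l1 w c"
    proof (cases "fin_pairing c (ev p) = 0")
      case True
      then show ?thesis using \<epsilon> weighted_l1_nonneg[of w c, OF w] by simp
    next
      case False
      \<comment> \<open>Normalises the pairing with \<open>p\<close> to 1, so that
        \<open>neg\<close> forces the norm above \<open>\<epsilon>\<close>.\<close>
      let ?r = "1 / fin_pairing c (ev p)"
      have "Poly_Mapping.keys (?r *\<^sub>R c) \<subseteq> K" using c(1) keys_scaleR_subset[of ?r c] by auto
      moreover have "\<forall>q\<in>span B. fin_pairing (?r *\<^sub>R c) (ev q) = 0"
        using z by (simp add: linear_scale[OF lin1])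
      moreover have "fin_pairing (?r *\<^sub>R c) (ev p) = 1"
        using False by (simp add: linear_scale[OF lin1])
      ultimately have "\<not> weighted_l1 w (?r *\<^sub>R c) \<le> \<epsilon>" using neg by blast
      then show ?thesis using \<epsilon> False by (simp add: weighted_l1_scaleR field_simps)
    qed
  qed (use \<epsilon> in auto)
  then obtain f where f: "f \<in> span B"
    "\<And>c. Poly_Mapping.keys c \<subseteq> K \<Longrightarrow> \<bar>fin_pairing c (ev (p - f))\<bar> \<le> (1 / \<epsilon>) * weighted_l1 w c"
    by auto
  \<comment> \<open>Testing the functional bound on the point mass at \<open>y\<close> gives a
    pointwise bound.\<close>
  have "\<bar>ev (p - f) y\<bar> \<le> (1 / \<epsilon>) * w y" if "y \<in> K" for y
    using f(2)[of "Poly_Mapping.single y 1"] that by (simp add: fin_pairing_def weighted_l1_def)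
  then have "p - f \<in> span B" by (rule B(2))
  then have "p - f + f \<in> span B" using f(1) by (rule span_add)
  then show False using p by simp
qed

text \<open>Smallness is possible because \<open>U\<close> vanishes on \<open>span B\<close>, which
  contains all vectors bounded by the weight. The elements of \<open>B'\<close> are added one at a
  time, each correction annihilating everything already interpolated.\<close>

lemma small_interpolation:
  fixes ev :: "'b::real_vector \<Rightarrow> 'y \<Rightarrow> real"
  assumes ev: "\<And>y. linear (\<lambda>p. ev p y)" and w: "\<And>y. 0 \<le> w y"
    and B: "finite B" "\<And>p M. (\<And>y. y \<in> K \<Longrightarrow> \<bar>ev p y\<bar> \<le> M * w y) \<Longrightarrow> p \<in> span B"
    and U: "linear U" "\<And>p. p \<in> B \<Longrightarrow> U p = 0"
    and "finite B'" and "0 < \<epsilon>"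
  shows "\<exists>c. Poly_Mapping.keys c \<subseteq> K \<and> (\<forall>q\<in>span (B \<union> B'). fin_pairing c (ev q) = U q) \<and>
    weighted_l1 w c \<le> \<epsilon>"
  using assms(7,8)
proof (induction B' arbitrary: \<epsilon> rule: finite_induct)
  case empty
  have "\<forall>q\<in>span B. U q = 0"
    using linear_eq_0_on_span[OF U] by blast
  then show ?case using empty
    by (intro exI[of _ 0]) (auto simp: fin_pairing_def weighted_l1_def)
next
  case (insert p B')
  note lin1 = linear_fin_pairing and lin2 = linear_fin_pairing_right[OF ev]
  obtain c where c: "Poly_Mapping.keys c \<subseteq> K" "\<And>q. q \<in> span (B \<union> B') \<Longrightarrow> fin_pairing c (ev q) = U q"
    "weighted_l1 w c \<le> \<epsilon> / 2"
    using insert.IH[of "\<epsilon> / 2"] insert.prems by auto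
  show ?case
  proof (cases "p \<in> span (B \<union> B')")
    case True
    then have "span (B \<union> insert p B') = span (B \<union> B')"
      by (simp add: span_redundant)
    then show ?thesis using c insert.prems by (intro exI[of _ c]) auto
  next
    case False
    define r where "r = U p - fin_pairing c (ev p)"
    have sub: "span B \<subseteq> span (B \<union> B')" by (intro span_mono) auto
    \<comment> \<open>The multiple \<open>r\<close> of \<open>e\<close> then costs at most
      \<open>\<epsilon> / 2\<close>; the \<open>+ 1\<close> keeps the bound meaningful when
      \<open>r = 0\<close>.\<close>
    have "\<exists>e. Poly_Mapping.keys e \<subseteq> K \<and> (\<forall>q\<in>span (B \<union> B'). fin_pairing e (ev q) = 0) \<and>
        fin_pairing e (ev p) = 1 \<and> weighted_l1 w e \<le> \<epsilon> / (2 * (\<bar>r\<bar> + 1))"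
    proof (rule small_annihilator[OF ev w _ _ False])
      show "p \<in> span (B \<union> B')" if "\<And>y. y \<in> K \<Longrightarrow> \<bar>ev p y\<bar> \<le> M * w y" for p M
        using B(2)[OF that] sub by blast
    qed (use insert.prems insert.hyps B(1) in auto)
    then obtain e where e: "Poly_Mapping.keys e \<subseteq> K" "\<And>q. q \<in> span (B \<union> B') \<Longrightarrow> fin_pairing e (ev q) = 0"
      "fin_pairing e (ev p) = 1" "weighted_l1 w e \<le> \<epsilon> / (2 * (\<bar>r\<bar> + 1))" by blast
    let ?d = "c + r *\<^sub>R e"
    have "Poly_Mapping.keys ?d \<subseteq> K"
      using subspace_add[OF subspace_supported_on _ subspace_scale[OF subspace_supported_on], of c K e r] c(1) e(1)
      by simp
    moreover have "\<forall>q\<in>span (B \<union> insert p B'). fin_pairing ?d (ev q) = U q"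
    proof
      fix q assume q: "q \<in> span (B \<union> insert p B')"
      show "fin_pairing ?d (ev q) = U q"
      proof (rule linear_eq_on_span[OF lin2 U(1) _ q])
        fix b assume "b \<in> B \<union> insert p B'"
        then show "fin_pairing ?d (ev b) = U b"
          using c(2)[of b] e(2)[of b] e(3) by (auto simp: linear_add[OF lin1] linear_scale[OF lin1] r_def span_base)
      qed
    qed
    moreover have "weighted_l1 w ?d \<le> \<epsilon>"
    proof -
      have "\<bar>r\<bar> * weighted_l1 w e \<le> \<bar>r\<bar> * (\<epsilon> / (2 * (\<bar>r\<bar> + 1)))"
        using e(4) by (rule mult_left_mono) simp
      also have "\<dots> \<le> \<epsilon> / 2" using insert.prems by (simp add: field_simps)
      finally show ?thesis
        using weighted_l1_add[of w c "r *\<^sub>R e", OF w] c(3) by (simp add: weighted_l1_scaleR)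
    qed
    ultimately show ?thesis by blast
  qed
qed

text \<open>Finitely supported \<open>C k\<close> match \<open>T\<close> on the \<open>k\<close>-th
  bounded space, and consecutive ones differ by at most \<open>(1 / 2) ^ k\<close> in the
  \<open>k\<close>-th norm. They are therefore Cauchy in every weighted norm. Here
  \<open>inj\<close> starts the recursion, \<open>fin\<close> makes each correction a finite
  problem, and \<open>cover\<close> places every \<open>p\<close> at some level.\<close>

lemma weighted_interpolation:
  fixes ev :: "'b::real_vector \<Rightarrow> 'y \<Rightarrow> real" and w :: "nat \<Rightarrow> 'y \<Rightarrow> real"
  assumes ev: "\<And>y. linear (\<lambda>p. ev p y)"
    and w_ge1: "\<And>d y. 1 \<le> w d y" and w_mono: "\<And>d e y. d \<le> e \<Longrightarrow> w d y \<le> w e y"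
    and inj: "\<And>p. (\<And>y. y \<in> K \<Longrightarrow> ev p y = 0) \<Longrightarrow> p = 0"
    and fin: "\<And>d. \<exists>B. finite B \<and> span B = {p. \<exists>M. \<forall>y\<in>K. \<bar>ev p y\<bar> \<le> M * w d y}"
    and cover: "\<And>p. \<exists>d M. \<forall>y\<in>K. \<bar>ev p y\<bar> \<le> M * w d y"
    and T: "linear T"
  shows "\<exists>c. (\<forall>d. (\<lambda>y. \<bar>c y\<bar> * w d y) summable_on K) \<and> (\<forall>p. ((\<lambda>y. c y * ev p y) has_sum T p) K)"
proof -
  define V where "V d = {p. \<exists>M. \<forall>y\<in>K. \<bar>ev p y\<bar> \<le> M * w d y}" for d
  obtain B where B: "\<And>d. finite (B d)" "\<And>d. span (B d) = V d"
    using fin unfolding V_def by metis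
  have w0: "0 \<le> w d y" for d y using w_ge1[of d y] by linarith
  have VI: "p \<in> V d" if "\<And>y. y \<in> K \<Longrightarrow> \<bar>ev p y\<bar> \<le> M * w d y" for p d M
    using that unfolding V_def by blast
  have V_Suc: "V d \<subseteq> V (Suc d)" for d
  proof
    fix p assume "p \<in> V d"
    then obtain M where M: "\<And>y. y \<in> K \<Longrightarrow> \<bar>ev p y\<bar> \<le> M * w d y" by (auto simp: V_def)
    show "p \<in> V (Suc d)"
    proof (rule VI)
      fix y assume "y \<in> K"
      then have "\<bar>ev p y\<bar> \<le> M * w d y" by (rule M)
      also have "\<dots> \<le> \<bar>M\<bar> * w (Suc d) y"
        using w_mono[of d "Suc d" y] w0 by (intro mult_mono) auto
      finally show "\<bar>ev p y\<bar> \<le> \<bar>M\<bar> * w (Suc d) y" .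
    qed
  qed
  note lin1 = linear_fin_pairing and lin2 = linear_fin_pairing_right[OF ev]
  define P where "P k c \<longleftrightarrow> Poly_Mapping.keys c \<subseteq> K \<and> (\<forall>q\<in>V k. fin_pairing c (ev q) = T q)" for k c
  define Q where "Q k c c' \<longleftrightarrow> weighted_l1 (w k) (c' - c) \<le> (1 / 2) ^ k" for k c c'
  have "\<exists>C. \<forall>k. P k (C k) \<and> Q k (C k) (C (Suc k))"
  proof (rule dependent_nat_choice)
    \<comment> \<open>With the zero weight the only bounded vector is 0, so interpolation on \<open>V 0\<close> is unobstructed.\<close>
    have "\<exists>c. Poly_Mapping.keys c \<subseteq> K \<and> (\<forall>q\<in>span ({} \<union> B 0). fin_pairing c (ev q) = T q) \<and>
        weighted_l1 (\<lambda>_. 0) c \<le> 1"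
      by (rule small_interpolation[OF ev]) (use T B(1) inj in auto)
    then show "\<exists>c. P 0 c" unfolding P_def using B(2)[of 0] by auto
  next
    fix c k assume c: "P k c"
    \<comment> \<open>The defect of \<open>c\<close> vanishes on \<open>V k\<close> by
      \<open>P k c\<close>, so it can be removed on \<open>V (Suc k)\<close> at small cost in the
      \<open>k\<close>-th norm.\<close>
    define U where "U q = T q - fin_pairing c (ev q)" for q
    have "\<exists>e. Poly_Mapping.keys e \<subseteq> K \<and> (\<forall>q\<in>span (B k \<union> B (Suc k)). fin_pairing e (ev q) = U q) \<and>
        weighted_l1 (w k) e \<le> (1 / 2) ^ k"
    proof (rule small_interpolation[OF ev w0 B(1) _ _ _ B(1)])
      show "p \<in> span (B k)" if "\<And>y. y \<in> K \<Longrightarrow> \<bar>ev p y\<bar> \<le> M * w k y" for p M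
        using VI[OF that] B(2) by simp
      show "linear U" unfolding U_def by (rule linear_compose_sub[OF T lin2])
      show "U p = 0" if "p \<in> B k" for p
        using c that span_base[of p "B k"] B(2)[of k] by (auto simp: U_def P_def)
    qed simp
    then obtain e where e: "Poly_Mapping.keys e \<subseteq> K"
      "\<And>q. q \<in> span (B k \<union> B (Suc k)) \<Longrightarrow> fin_pairing e (ev q) = U q"
      "weighted_l1 (w k) e \<le> (1 / 2) ^ k" by blast
    have "V (Suc k) \<subseteq> span (B k \<union> B (Suc k))"
      using B(2)[of "Suc k"] span_mono[of "B (Suc k)" "B k \<union> B (Suc k)"] by auto
    then have "P (Suc k) (c + e)"
      using c e(1,2) keys_add[of c e] by (auto simp: P_def linear_add[OF lin1] U_def)
    moreover have "Q k c (c + e)" using e(3) by (simp add: Q_def)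
    ultimately show "\<exists>c'. P (Suc k) c' \<and> Q k c c'" by blast
  qed
  then obtain C where C: "\<And>k. Poly_Mapping.keys (C k) \<subseteq> K"
    "\<And>k q. q \<in> V k \<Longrightarrow> fin_pairing (C k) (ev q) = T q"
    "\<And>k. weighted_l1 (w k) (C (Suc k) - C k) \<le> (1 / 2) ^ k"
    unfolding P_def Q_def by blast
  define a where "a k y = Poly_Mapping.lookup (C k) y" for k y
  \<comment> \<open>The right side is the exact sum of \<open>(1 / 2) ^ j\<close> for
    \<open>k\<close> \<le> \<open>j\<close> < \<open>k + n\<close>, which is what the induction
    needs. As \<open>d\<close> \<le> \<open>k\<close>, the \<open>d\<close>-th norm of each
    increment is below the norm that controls it.\<close>
  have step: "weighted_l1 (w d) (C (k + n) - C k) \<le> 2 * (1 / 2) ^ k * (1 - (1 / 2) ^ n)" if "d \<le> k" for d k n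
  proof (induction n)
    case 0
    then show ?case by (simp add: weighted_l1_def)
  next
    case (Suc n)
    have "weighted_l1 (w d) (C (k + Suc n) - C k)
        = weighted_l1 (w d) ((C (Suc (k + n)) - C (k + n)) + (C (k + n) - C k))"
      by simp
    also have "\<dots> \<le> weighted_l1 (w d) (C (Suc (k + n)) - C (k + n)) + weighted_l1 (w d) (C (k + n) - C k)"
      by (rule weighted_l1_add[OF w0])
    also have "weighted_l1 (w d) (C (Suc (k + n)) - C (k + n))
        \<le> weighted_l1 (w (k + n)) (C (Suc (k + n)) - C (k + n))"
      using that by (intro weighted_l1_mono w_mono) auto
    also have "\<dots> \<le> (1 / 2) ^ (k + n)" by (rule C(3))
    also have "(1 / 2) ^ (k + n) + weighted_l1 (w d) (C (k + n) - C k)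
        \<le> 2 * (1 / 2) ^ k * (1 - (1 / 2 :: real) ^ Suc n)"
      using Suc.IH by (simp add: power_add algebra_simps)
    finally show ?case by simp
  qed
  have tail: "(\<Sum>y\<in>Y. \<bar>a (k + n) y - a k y\<bar> * w d y) \<le> 2 * (1 / 2) ^ k" if "d \<le> k" "finite Y" for d k n Y
  proof -
    have "(\<Sum>y\<in>Y. \<bar>a (k + n) y - a k y\<bar> * w d y) \<le> weighted_l1 (w d) (C (k + n) - C k)"
      using sum_le_weighted_l1[of "w d" Y "C (k + n) - C k", OF w0 that(2)] by (simp add: a_def lookup_minus)
    also have "\<dots> \<le> 2 * (1 / 2) ^ k * (1 - (1 / 2) ^ n)" by (rule step[OF that(1)])
    also have "\<dots> \<le> 2 * (1 / 2) ^ k * 1" by (intro mult_left_mono) auto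
    finally show ?thesis by simp
  qed
  \<comment> \<open>Weights are at least 1, so the tail bound on the singleton of \<open>y\<close>
    makes the increments summable, and they telescope.\<close>
  have "\<exists>l. (\<lambda>k. a k y) \<longlonglongrightarrow> l" for y
  proof -
    have "norm (a (Suc k) y - a k y) \<le> 2 * (1 / 2) ^ k" for k
    proof -
      have "\<bar>a (Suc k) y - a k y\<bar> * 1 \<le> \<bar>a (Suc k) y - a k y\<bar> * w 0 y"
        by (rule mult_left_mono[OF w_ge1]) simp
      then show ?thesis using tail[of 0 k "{y}" 1] by simp
    qed
    moreover have "summable (\<lambda>k. 2 * (1 / 2 :: real) ^ k)"
      by (intro summable_mult summable_geometric) simp
    ultimately have "summable (\<lambda>k. a (Suc k) y - a k y)"
      by (rule summable_comparison_test'[where N = 0, rotated])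
    then have "(\<lambda>k. \<Sum>i<k. a (Suc i) y - a i y) \<longlonglongrightarrow> suminf (\<lambda>k. a (Suc k) y - a k y)"
      by (rule summable_LIMSEQ)
    moreover have "(\<Sum>i<k. a (Suc i) y - a i y) = a k y - a 0 y" for k
      by (rule sum_lessThan_telescope)
    ultimately have "(\<lambda>k. (a k y - a 0 y) + a 0 y) \<longlonglongrightarrow> suminf (\<lambda>k. a (Suc k) y - a k y) + a 0 y"
      by (intro tendsto_add tendsto_const) simp
    then show ?thesis by auto
  qed
  then obtain c where c: "\<And>y. (\<lambda>k. a k y) \<longlonglongrightarrow> c y" by metis
  \<comment> \<open>Letting \<open>n\<close> tend to infinity in \<open>tail\<close> is legitimate
    because \<open>Y\<close> is finite; the bound does not depend on \<open>Y\<close>.\<close>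
  have ctail: "(\<Sum>y\<in>Y. \<bar>c y - a k y\<bar> * w d y) \<le> 2 * (1 / 2) ^ k" if "d \<le> k" "finite Y" for d k Y
  proof (rule LIMSEQ_le_const2)
    show "(\<lambda>n. \<Sum>y\<in>Y. \<bar>a (n + k) y - a k y\<bar> * w d y) \<longlonglongrightarrow> (\<Sum>y\<in>Y. \<bar>c y - a k y\<bar> * w d y)"
      by (intro tendsto_intros LIMSEQ_ignore_initial_segment c)
    show "\<exists>N. \<forall>n\<ge>N. (\<Sum>y\<in>Y. \<bar>a (n + k) y - a k y\<bar> * w d y) \<le> 2 * (1 / 2) ^ k"
      using tail[OF that] by (auto simp: add.commute)
  qed
  \<comment> \<open>Split \<open>c\<close> into the finitely supported \<open>a d\<close> and a
    remainder controlled by \<open>ctail\<close> at level \<open>d\<close>.\<close>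
  have summ: "(\<lambda>y. \<bar>c y\<bar> * w d y) summable_on K" for d
  proof (rule nonneg_bdd_above_summable_on)
    show "bdd_above (sum (\<lambda>y. \<bar>c y\<bar> * w d y) ` {F. F \<subseteq> K \<and> finite F})"
    proof (rule bdd_aboveI2)
      fix F assume F: "F \<in> {F. F \<subseteq> K \<and> finite F}"
      have "(\<Sum>y\<in>F. \<bar>c y\<bar> * w d y) \<le> (\<Sum>y\<in>F. \<bar>c y - a d y\<bar> * w d y + \<bar>a d y\<bar> * w d y)"
        using w0 by (intro sum_mono) (auto simp: distrib_right[symmetric] intro!: mult_right_mono)
      also have "\<dots> \<le> 2 * (1 / 2) ^ d + weighted_l1 (w d) (C d)"
        unfolding sum.distrib using F ctail[of d d F] sum_le_weighted_l1[of "w d" F "C d", OF w0]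
        by (intro add_mono) (auto simp: a_def)
      finally show "(\<Sum>y\<in>F. \<bar>c y\<bar> * w d y) \<le> 2 * (1 / 2) ^ d + weighted_l1 (w d) (C d)" .
    qed
  qed (use w0 in auto)
  have "((\<lambda>y. c y * ev p y) has_sum T p) K" for p
  proof -
    obtain d M where M: "\<And>y. y \<in> K \<Longrightarrow> \<bar>ev p y\<bar> \<le> M * w d y" using cover[of p] by blast
    have le: "\<bar>x * ev p y\<bar> \<le> \<bar>M\<bar> * (\<bar>x\<bar> * w d y)" if "y \<in> K" for x y
    proof -
      have "\<bar>x * ev p y\<bar> \<le> \<bar>x\<bar> * (M * w d y)"
        unfolding abs_mult using M[OF that] by (intro mult_left_mono) auto
      also have "\<dots> \<le> \<bar>x\<bar> * (\<bar>M\<bar> * w d y)"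
        using w0 by (intro mult_left_mono mult_right_mono) auto
      finally show ?thesis by (simp add: mult_ac)
    qed
    have "(\<lambda>y. norm (c y * ev p y)) summable_on K"
      by (rule summable_on_comparison_test[OF summable_on_cmult_right[OF summ[of d], of "\<bar>M\<bar>"]])
         (use le in auto)
    then have s: "(\<lambda>y. c y * ev p y) summable_on K" by (rule abs_summable_summable)
    \<comment> \<open>For \<open>k\<close> \<ge> \<open>d\<close> the vector \<open>p\<close> lies
      in \<open>V k\<close>, so \<open>a k\<close> pairs with it to exactly \<open>T p\<close>. The
      whole error comes from \<open>c - a k\<close>, bounded on finite subsets of \<open>K\<close>
      by \<open>ctail\<close> and then in the limit.\<close>
    have close: "\<bar>infsum (\<lambda>y. c y * ev p y) K - T p\<bar> \<le> \<bar>M\<bar> * (2 * (1 / 2) ^ k)" if k: "d \<le> k" for k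
    proof -
      have pV: "p \<in> V k"
      proof (rule VI)
        fix y assume "y \<in> K"
        have "\<bar>ev p y\<bar> \<le> \<bar>M\<bar> * w d y" using le[OF \<open>y \<in> K\<close>, of 1] by simp
        also have "\<dots> \<le> \<bar>M\<bar> * w k y" using w_mono[OF k] by (intro mult_left_mono) auto
        finally show "\<bar>ev p y\<bar> \<le> \<bar>M\<bar> * w k y" .
      qed
      let ?Y = "Poly_Mapping.keys (C k)"
      have "((\<lambda>y. a k y * ev p y) has_sum (\<Sum>y\<in>?Y. a k y * ev p y)) K"
        by (rule has_sum_finite_neutralI) (use C(1) in \<open>auto simp: a_def in_keys_iff\<close>)
      then have T: "((\<lambda>y. a k y * ev p y) has_sum T p) K"
        using C(2)[OF pV] by (simp add: fin_pairing_def a_def)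
      then have T': "((\<lambda>y. - (a k y * ev p y)) has_sum - T p) K"
        by (simp add: has_sum_uminus)
      have hs: "((\<lambda>y. c y * ev p y - a k y * ev p y) has_sum (infsum (\<lambda>y. c y * ev p y) K - T p)) K"
        using has_sum_add[OF has_sum_infsum[OF s] T'] by simp
      then have hs': "((\<lambda>F. \<bar>\<Sum>y\<in>F. c y * ev p y - a k y * ev p y\<bar>) \<longlongrightarrow>
          \<bar>infsum (\<lambda>y. c y * ev p y) K - T p\<bar>) (finite_subsets_at_top K)"
        unfolding has_sum_def by (rule tendsto_rabs)
      show ?thesis
      proof (rule tendsto_upperbound[OF hs'])
        show "\<forall>\<^sub>F F in finite_subsets_at_top K.
            \<bar>\<Sum>y\<in>F. c y * ev p y - a k y * ev p y\<bar> \<le> \<bar>M\<bar> * (2 * (1 / 2) ^ k)"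
        proof (rule eventually_finite_subsets_at_top_weakI)
          fix F assume F: "finite F" "F \<subseteq> K"
          have "\<bar>\<Sum>y\<in>F. c y * ev p y - a k y * ev p y\<bar> \<le> (\<Sum>y\<in>F. \<bar>(c y - a k y) * ev p y\<bar>)"
            by (simp add: left_diff_distrib)
          also have "\<dots> \<le> (\<Sum>y\<in>F. \<bar>M\<bar> * (\<bar>c y - a k y\<bar> * w d y))"
            using F by (intro sum_mono le) auto
          also have "\<dots> \<le> \<bar>M\<bar> * (2 * (1 / 2) ^ k)"
            unfolding sum_distrib_left[symmetric] using ctail[OF k F(1)] by (intro mult_left_mono) auto
          finally show "\<bar>\<Sum>y\<in>F. c y * ev p y - a k y * ev p y\<bar> \<le> \<bar>M\<bar> * (2 * (1 / 2) ^ k)" .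
        qed
      qed simp
    qed
    have "(\<lambda>k. \<bar>M\<bar> * (2 * (1 / 2) ^ k)) \<longlonglongrightarrow> \<bar>M\<bar> * (2 * 0)"
      by (intro tendsto_intros LIMSEQ_power_zero) simp
    then have "\<bar>infsum (\<lambda>y. c y * ev p y) K - T p\<bar> \<le> \<bar>M\<bar> * (2 * 0)"
      by (rule LIMSEQ_le_const) (use close in blast)
    then have "infsum (\<lambda>y. c y * ev p y) K = T p" by simp
    then show ?thesis using has_sum_infsum[OF s] by simp
  qed
  with summ show ?thesis by blast
qed

subsection \<open>Exchanging countable sums and integrals\<close>

lemma has_sum_sum:
  fixes f :: "'i \<Rightarrow> 'b \<Rightarrow> 'c::topological_comm_monoid_add"
  assumes "\<And>i. i \<in> I \<Longrightarrow> (f i has_sum l i) K"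
  shows "((\<lambda>y. \<Sum>i\<in>I. f i y) has_sum (\<Sum>i\<in>I. l i)) K"
  using assms by (induction I rule: infinite_finite_induct) (auto intro: has_sum_add)

text \<open>Turns sums over \<open>K\<close> into series over the naturals, where the theorems on
  integrating series apply. Padding with 0 treats finite and infinite \<open>K\<close>
  alike.\<close>

lemma has_sum_countable_iff:
  assumes "countable K"
  shows "((\<lambda>n. if n \<in> to_nat_on K ` K then h (from_nat_into K n) else 0) has_sum l) UNIV
    \<longleftrightarrow> (h has_sum l) K"
proof -
  have inj: "inj_on (to_nat_on K) K" using assms by (rule inj_on_to_nat_on)
  have "((\<lambda>n. if n \<in> to_nat_on K ` K then h (from_nat_into K n) else 0) has_sum l) UNIV
      \<longleftrightarrow> ((\<lambda>n. h (from_nat_into K n)) has_sum l) (to_nat_on K ` K)"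
    by (rule has_sum_cong_neutral) auto
  also have "\<dots> \<longleftrightarrow> (h has_sum l) K"
    unfolding has_sum_reindex[OF inj] using assms by (intro has_sum_cong) auto
  finally show ?thesis .
qed

text \<open>Tonelli gives absolute summability almost everywhere, and then the series may be
  integrated termwise. The sum is represented by an integrable \<open>F\<close>, since the pointwise
  \<open>infsum\<close> agrees with it only almost everywhere and \<open>M\<close> may be
  incomplete.\<close>

lemma integral_infsum_countable:
  fixes f :: "'a \<Rightarrow> 'b \<Rightarrow> 'c::{banach, second_countable_topology}"
  assumes K: "countable K" and int: "\<And>y. y \<in> K \<Longrightarrow> integrable M (f y)"
    and sm: "(\<lambda>y. \<integral>x. norm (f y x) \<partial>M) summable_on K"
  shows "AE x in M. (\<lambda>y. norm (f y x)) summable_on K"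
    and "\<exists>F. integrable M F \<and> (AE x in M. F x = (\<Sum>\<^sub>\<infinity>y\<in>K. f y x)) \<and>
      ((\<lambda>y. \<integral>x. f y x \<partial>M) has_sum (\<integral>x. F x \<partial>M)) K"
proof -
  define u where "u n x = (if n \<in> to_nat_on K ` K then f (from_nat_into K n) x else 0)" for n x
  note tr = has_sum_countable_iff[OF K]
  have u_int: "integrable M (u n)" for n
    using int K by (cases "n \<in> to_nat_on K ` K") (auto simp: u_def[abs_def])
  then have [measurable]: "u n \<in> borel_measurable M" for n
    by (rule borel_measurable_integrable)
  have norm_u: "norm (u n x) = (if n \<in> to_nat_on K ` K then norm (f (from_nat_into K n) x) else 0)" for n x
    by (simp add: u_def)
  have int_norm_u: "(\<integral>x. norm (u n x) \<partial>M) =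
      (if n \<in> to_nat_on K ` K then \<integral>x. norm (f (from_nat_into K n) x) \<partial>M else 0)" for n
    by (simp add: u_def)
  have int_u: "(\<integral>x. u n x \<partial>M) =
      (if n \<in> to_nat_on K ` K then \<integral>x. f (from_nat_into K n) x \<partial>M else 0)" for n
    by (simp add: u_def)
  have "((\<lambda>n. \<integral>x. norm (u n x) \<partial>M) has_sum (\<Sum>\<^sub>\<infinity>y\<in>K. \<integral>x. norm (f y x) \<partial>M)) UNIV"
    unfolding int_norm_u by (rule tr[THEN iffD2, OF has_sum_infsum[OF sm]])
  then have su: "summable (\<lambda>n. \<integral>x. norm (u n x) \<partial>M)"
    using has_sum_imp_sums sums_summable by blast
  \<comment> \<open>Tonelli for the norms: the integral of their sum is finite, so the sum itself is
    finite almost everywhere.\<close>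
  have "(\<integral>\<^sup>+x. (suminf (\<lambda>n. ennreal (norm (u n x)))) \<partial>M) = suminf (\<lambda>n. \<integral>\<^sup>+x. ennreal (norm (u n x)) \<partial>M)"
    by (rule nn_integral_suminf) measurable
  also have "\<dots> = suminf (\<lambda>n. ennreal (\<integral>x. norm (u n x) \<partial>M))"
    using u_int by (intro suminf_cong nn_integral_eq_integral) auto
  also have "\<dots> = ennreal (suminf (\<lambda>n. \<integral>x. norm (u n x) \<partial>M))"
    using su by (intro suminf_ennreal2) auto
  finally have "(\<integral>\<^sup>+x. (suminf (\<lambda>n. ennreal (norm (u n x)))) \<partial>M) \<noteq> \<infinity>" by simp
  then have "AE x in M. (suminf (\<lambda>n. ennreal (norm (u n x)))) \<noteq> \<infinity>"
    by (intro nn_integral_PInf_AE) measurable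
  then have ae: "AE x in M. summable (\<lambda>n. norm (u n x))"
    by (rule AE_mp) (auto intro!: AE_I2 summable_suminf_not_top)
  then show "AE x in M. (\<lambda>y. norm (f y x)) summable_on K"
  proof (rule AE_mp, intro AE_I2 impI)
    fix x assume "summable (\<lambda>n. norm (u n x))"
    then have "(\<lambda>n. norm (u n x)) summable_on UNIV"
      by (intro summable_nonneg_imp_summable_on) auto
    then show "(\<lambda>y. norm (f y x)) summable_on K"
      unfolding norm_u summable_on_def using tr[of "\<lambda>y. norm (f y x)"] by simp
  qed
  let ?F = "\<lambda>x. suminf (\<lambda>n. u n x)"
  have "AE x in M. ?F x = (\<Sum>\<^sub>\<infinity>y\<in>K. f y x)"
    using ae
  proof (rule AE_mp, intro AE_I2 impI)
    fix x assume s: "summable (\<lambda>n. norm (u n x))"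
    have "((\<lambda>n. u n x) has_sum ?F x) UNIV"
      by (rule norm_summable_imp_has_sum[OF s summable_sums[OF summable_norm_cancel[OF s]]])
    then have "((\<lambda>y. f y x) has_sum ?F x) K"
      unfolding u_def using tr[of "\<lambda>y. f y x"] by simp
    then show "?F x = (\<Sum>\<^sub>\<infinity>y\<in>K. f y x)" by (simp add: infsumI)
  qed
  moreover have "((\<lambda>n. \<integral>x. u n x \<partial>M) has_sum (\<integral>x. ?F x \<partial>M)) UNIV"
  proof (rule norm_summable_imp_has_sum)
    show "summable (\<lambda>n. norm (\<integral>x. u n x \<partial>M))"
      using su by (rule summable_comparison_test') auto
  qed (rule sums_integral[OF u_int ae su])
  then have "((\<lambda>y. \<integral>x. f y x \<partial>M) has_sum (\<integral>x. ?F x \<partial>M)) K"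
    unfolding int_u by (rule tr[of "\<lambda>y. \<integral>x. f y x \<partial>M", THEN iffD1])
  ultimately show "\<exists>F. integrable M F \<and> (AE x in M. F x = (\<Sum>\<^sub>\<infinity>y\<in>K. f y x)) \<and>
      ((\<lambda>y. \<integral>x. f y x \<partial>M) has_sum (\<integral>x. F x \<partial>M)) K"
    using integrable_suminf[OF u_int ae su] by blast
qed

section \<open>Translation invariance of the Lebesgue integral\<close>

lemma measurable_lebesgue_translate: "(\<lambda>x. t + x) \<in> lebesgue \<rightarrow>\<^sub>M (lebesgue :: 'a::euclidean_space measure)"
  using lebesgue_affine_measurable[of "\<lambda>_::'a. 1" t] by (simp add: euclidean_representation)

lemma distr_lebesgue_translate: "distr lebesgue lebesgue (\<lambda>x. t + x) = (lebesgue :: 'a::euclidean_space measure)"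
  using lebesgue_affine_euclidean[of "\<lambda>_::'a. 1" t] by (simp add: euclidean_representation density_1)

lemma
  fixes f :: "'a::euclidean_space \<Rightarrow> 'b::{banach, second_countable_topology}"
  assumes "f \<in> borel_measurable lebesgue"
  shows integrable_lebesgue_translate_iff: "integrable lebesgue (\<lambda>x. f (t + x)) \<longleftrightarrow> integrable lebesgue f"
    and integral_lebesgue_translate: "(\<integral>x. f (t + x) \<partial>lebesgue) = (\<integral>x. f x \<partial>lebesgue)"
  using integrable_distr_eq[OF measurable_lebesgue_translate assms, of t]
    integral_distr[OF measurable_lebesgue_translate assms, of t]
  by (simp_all add: distr_lebesgue_translate)

subsection \<open>The moment problem on a point set\<close>

definition mdeg :: "nat ^ 'n::finite \<Rightarrow> nat" where
  "mdeg \<alpha> = (\<Sum>i\<in>UNIV. \<alpha> $ i)"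

definition poly_weight :: "nat \<Rightarrow> real ^ 'n::finite \<Rightarrow> real" where
  "poly_weight d x = (1 + (norm x)\<^sup>2) ^ d"

lemma one_le_poly_weight: "1 \<le> poly_weight d x"
  by (simp add: poly_weight_def one_le_power)

lemma poly_weight_nonneg: "0 \<le> poly_weight d x"
  using one_le_poly_weight[of d x] by linarith

lemma poly_weight_mono: "d \<le> e \<Longrightarrow> poly_weight d x \<le> poly_weight e x"
  unfolding poly_weight_def by (rule power_increasing) auto

text \<open>Uses \<open>r\<close> \<le> \<open>(1 + r^2) / 2\<close> and \<open>(a + b) / 2\<close>
  \<le> \<open>a * b\<close> for \<open>a\<close>, \<open>b\<close> \<ge> 1.\<close>

lemma norm_add_le_poly_weight: "norm (x + y) \<le> (1 + (norm x)\<^sup>2) * (1 + (norm y)\<^sup>2)"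
proof -
  have h: "r \<le> (1 + r\<^sup>2) / 2" for r :: real
    using sum_squares_bound[of 1 r] by simp
  have "norm (x + y) \<le> norm x + norm y" by (rule norm_triangle_ineq)
  also have "\<dots> \<le> (1 + (norm x)\<^sup>2) / 2 + (1 + (norm y)\<^sup>2) / 2" by (intro add_mono h)
  also have "\<dots> \<le> (1 + (norm x)\<^sup>2) * (1 + (norm y)\<^sup>2)"
    by (simp add: field_simps)
  finally show ?thesis .
qed

text \<open>The product form lets the integral over \<open>x\<close> and the sum over
  \<open>y\<close> be estimated separately.\<close>

lemma abs_vpow_add_le: "\<bar>vpow (x + y) \<alpha>\<bar> \<le> poly_weight (mdeg \<alpha>) x * poly_weight (mdeg \<alpha>) y"
proof -
  have "\<bar>vpow (x + y) \<alpha>\<bar> = (\<Prod>i\<in>UNIV. \<bar>(x + y) $ i\<bar> ^ (\<alpha> $ i))"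
    by (simp add: vpow_def abs_prod power_abs)
  also have "\<dots> \<le> (\<Prod>i\<in>UNIV. ((1 + (norm x)\<^sup>2) * (1 + (norm y)\<^sup>2)) ^ (\<alpha> $ i))"
    using component_le_norm_cart[of "x + y"] norm_add_le_poly_weight[of x y]
    by (intro prod_mono conjI power_mono) (auto intro: order_trans)
  also have "\<dots> = poly_weight (mdeg \<alpha>) x * poly_weight (mdeg \<alpha>) y"
    by (simp only: poly_weight_def mdeg_def power_sum power_mult_distrib prod.distrib)
  finally show ?thesis .
qed

lemma abs_vpow_le: "\<bar>vpow y \<alpha>\<bar> \<le> poly_weight (mdeg \<alpha>) y"
  using abs_vpow_add_le[of 0 y \<alpha>] by (simp add: poly_weight_def)

section \<open>Multi-index binomial expansion and triangular systems\<close>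

lemma finite_multiindices_le: "finite {\<beta> :: nat ^ 'n::finite. \<forall>i. \<beta> $ i \<le> \<alpha> $ i}"
proof -
  have "{\<beta> :: nat ^ 'n. \<forall>i. \<beta> $ i \<le> \<alpha> $ i} = vec_lambda ` (PiE UNIV (\<lambda>i. {..\<alpha> $ i}))"
    by (auto simp: image_iff PiE_def intro!: bexI[of _ "\<lambda>i. _ $ i"])
  then show ?thesis by (simp add: finite_PiE)
qed

text \<open>Apply the binomial theorem in each coordinate and distribute the product of sums; the
  resulting choice functions are the multi-indices below \<open>\<alpha>\<close>.\<close>

lemma vpow_add:
  "vpow (x + y) \<alpha> = (\<Sum>\<beta> | \<forall>i. \<beta> $ i \<le> \<alpha> $ i.
     (\<Prod>i\<in>UNIV. real ((\<alpha> $ i) choose (\<beta> $ i))) * vpow x (\<alpha> - \<beta>) * vpow y \<beta>)"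
proof -
  have "vpow (x + y) \<alpha> = (\<Prod>i\<in>UNIV. \<Sum>k\<le>\<alpha> $ i. real ((\<alpha> $ i) choose k) * (y $ i) ^ k * (x $ i) ^ (\<alpha> $ i - k))"
    by (simp add: vpow_def add.commute[of "x $ _"] binomial_ring)
  also have "\<dots> = (\<Sum>h\<in>PiE UNIV (\<lambda>i. {..\<alpha> $ i}).
      \<Prod>i\<in>UNIV. real ((\<alpha> $ i) choose h i) * (y $ i) ^ h i * (x $ i) ^ (\<alpha> $ i - h i))"
    by (rule prod_sum_PiE) auto
  also have "\<dots> = (\<Sum>\<beta> | \<forall>i. \<beta> $ i \<le> \<alpha> $ i.
      \<Prod>i\<in>UNIV. real ((\<alpha> $ i) choose \<beta> $ i) * (y $ i) ^ (\<beta> $ i) * (x $ i) ^ (\<alpha> $ i - \<beta> $ i))"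
    by (rule sum.reindex_bij_witness[of _ "\<lambda>\<beta> i. \<beta> $ i" vec_lambda]) (auto simp: PiE_def)
  finally show ?thesis by (simp add: vpow_def prod.distrib mult_ac)
qed

text \<open>Forward substitution by well-founded recursion on the total degree: every \<beta> in row
  \<alpha> other than \<alpha> has smaller degree, and the diagonal entry can be divided
  out.\<close>

lemma triangular_system_solvable:
  fixes A :: "nat ^ 'n::finite \<Rightarrow> nat ^ 'n \<Rightarrow> 'a::field"
  assumes "\<And>\<alpha>. A \<alpha> \<alpha> \<noteq> 0"
  shows "\<exists>t. \<forall>\<alpha>. (\<Sum>\<beta> | \<forall>i. \<beta> $ i \<le> \<alpha> $ i. A \<alpha> \<beta> * t \<beta>) = s \<alpha>"
proof -
  define D where "D \<alpha> = {\<beta> :: nat ^ 'n. \<forall>i. \<beta> $ i \<le> \<alpha> $ i}" for \<alpha>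
  define F where "F t \<alpha> = (s \<alpha> - (\<Sum>\<beta>\<in>D \<alpha> - {\<alpha>}. A \<alpha> \<beta> * t \<beta>)) / A \<alpha> \<alpha>" for t \<alpha>
  have less: "mdeg \<beta> < mdeg \<alpha>" if "\<beta> \<in> D \<alpha> - {\<alpha>}" for \<alpha> \<beta>
  proof -
    from that obtain i where "\<beta> $ i \<noteq> \<alpha> $ i" by (auto simp: vec_eq_iff)
    with that show ?thesis unfolding mdeg_def D_def
      by (intro sum_strict_mono_ex1) (auto intro!: bexI[of _ i] simp: order_less_le)
  qed
  have "adm_wf (Wellfounded.measure mdeg) F"
    using less by (auto simp: adm_wf_def F_def intro!: sum.cong arg_cong[where f = "\<lambda>z. (_ - z) / _"])
  then have fp: "wfrec (Wellfounded.measure mdeg) F = F (wfrec (Wellfounded.measure mdeg) F)"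
    by (intro wfrec_fixpoint) auto
  define t where "t = wfrec (Wellfounded.measure mdeg) F"
  have "(\<Sum>\<beta>\<in>D \<alpha>. A \<alpha> \<beta> * t \<beta>) = s \<alpha>" for \<alpha>
  proof -
    have "t \<alpha> = F t \<alpha>" unfolding t_def by (rule fun_cong[OF fp])
    moreover have "finite (D \<alpha>)" "\<alpha> \<in> D \<alpha>" by (auto simp: D_def finite_multiindices_le)
    ultimately show ?thesis
      using assms[of \<alpha>] by (simp add: F_def sum.remove[of "D \<alpha>" \<alpha>])
  qed
  then show ?thesis unfolding D_def by blast
qed

section \<open>Polynomials as test vectors for families on \<open>K\<close>\<close>

lemma mpeval_eq_fin_pairing: "mpeval p x = fin_pairing p (vpow x)"
  by (simp add: mpeval_def fin_pairing_def)

lemma linear_mpeval: "linear (\<lambda>p. mpeval p x)"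
  unfolding mpeval_eq_fin_pairing by (rule linear_fin_pairing)

text \<open>Supplies the covering hypothesis of the interpolation: every polynomial lies in some
  growth space. The sum of the degrees is a crude common bound for them.\<close>

lemma abs_mpeval_le: "\<exists>d M. \<forall>y. \<bar>mpeval p y\<bar> \<le> M * poly_weight d y"
proof -
  let ?k = "Poly_Mapping.keys p" and ?l = "Poly_Mapping.lookup p"
  define d where "d = (\<Sum>\<alpha>\<in>?k. mdeg \<alpha>)"
  have "\<bar>mpeval p y\<bar> \<le> (\<Sum>\<alpha>\<in>?k. \<bar>?l \<alpha>\<bar>) * poly_weight d y" for y
  proof -
    have "\<bar>mpeval p y\<bar> \<le> (\<Sum>\<alpha>\<in>?k. \<bar>?l \<alpha>\<bar> * \<bar>vpow y \<alpha>\<bar>)"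
      unfolding mpeval_def abs_mult[symmetric] by (rule sum_abs)
    also have "\<dots> \<le> (\<Sum>\<alpha>\<in>?k. \<bar>?l \<alpha>\<bar> * poly_weight d y)"
    proof (intro sum_mono mult_left_mono)
      fix \<alpha> assume "\<alpha> \<in> ?k"
      then have "mdeg \<alpha> \<le> d" unfolding d_def by (intro member_le_sum) auto
      then show "\<bar>vpow y \<alpha>\<bar> \<le> poly_weight d y"
        by (intro order_trans[OF abs_vpow_le] poly_weight_mono)
    qed simp
    finally show ?thesis by (simp add: sum_distrib_right)
  qed
  then show ?thesis by blast
qed

lemma growth_space_eq: "growth_space d K = {p. \<exists>M. \<forall>y\<in>K. \<bar>mpeval p y\<bar> \<le> M * poly_weight d y}"
proof -
  have "\<bar>mpeval p y\<bar> / (1 + (norm y)\<^sup>2) ^ d \<le> M \<longleftrightarrow> \<bar>mpeval p y\<bar> \<le> M * poly_weight d y"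
    for p :: "'a real_mpoly" and M y
    unfolding poly_weight_def[symmetric] using one_le_poly_weight[of d y] by (intro pos_divide_le_eq) linarith
  then show ?thesis by (simp add: growth_space_def bdd_above_def)
qed

text \<open>Interpolation with polynomials as vectors and point evaluations as functionals. The
  target is the Riesz functional of \<open>t\<close>, which sends \<open>p\<close> to
  \<open>fin_pairing p t\<close>; Zariski density is injectivity, and monomials recover the
  moments.\<close>

lemma real_moment_problem_on_points:
  fixes K :: "(real ^ 'n::finite) set"
  assumes "zariski_dense K" "\<And>d. finite_dim (growth_space d K)"
  shows "\<exists>c. (\<forall>d. (\<lambda>y. \<bar>c y\<bar> * poly_weight d y) summable_on K) \<and>
    (\<forall>\<alpha>. ((\<lambda>y. c y * vpow y \<alpha>) has_sum t \<alpha>) K)"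
proof -
  have "\<exists>c. (\<forall>d. (\<lambda>y. \<bar>c y\<bar> * poly_weight d y) summable_on K) \<and>
    (\<forall>p. ((\<lambda>y. c y * mpeval p y) has_sum fin_pairing p t) K)"
  proof (rule weighted_interpolation[OF linear_mpeval one_le_poly_weight poly_weight_mono])
    show "p = 0" if "\<And>y. y \<in> K \<Longrightarrow> mpeval p y = 0" for p
      using assms(1) that by (simp add: zariski_dense_def)
    show "\<exists>B. finite B \<and> span B = {p. \<exists>M. \<forall>y\<in>K. \<bar>mpeval p y\<bar> \<le> M * poly_weight d y}" for d
      using assms(2)[of d] unfolding finite_dim_def growth_space_eq .
    show "\<exists>d M. \<forall>y\<in>K. \<bar>mpeval p y\<bar> \<le> M * poly_weight d y" for p
      using abs_mpeval_le[of p] by blast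
  qed (auto intro: linear_fin_pairing)
  then obtain c where c: "\<And>d. (\<lambda>y. \<bar>c y\<bar> * poly_weight d y) summable_on K"
    "\<And>p. ((\<lambda>y. c y * mpeval p y) has_sum fin_pairing p t) K" by blast
  have "((\<lambda>y. c y * vpow y \<alpha>) has_sum t \<alpha>) K" for \<alpha>
    using c(2)[of "Poly_Mapping.single \<alpha> 1"] by (simp add: mpeval_def fin_pairing_def)
  then show ?thesis using c(1) by blast
qed

lemma complex_moment_problem_on_points:
  fixes K :: "(real ^ 'n::finite) set"
  assumes "zariski_dense K" "\<And>d. finite_dim (growth_space d K)"
  shows "\<exists>c. (\<forall>d. (\<lambda>y. cmod (c y) * poly_weight d y) summable_on K) \<and>
    (\<forall>\<alpha>. ((\<lambda>y. c y * complex_of_real (vpow y \<alpha>)) has_sum t \<alpha>) K)"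
proof -
  obtain a where a: "\<And>d. (\<lambda>y. \<bar>a y\<bar> * poly_weight d y) summable_on K"
    "\<And>\<alpha>. ((\<lambda>y. a y * vpow y \<alpha>) has_sum Re (t \<alpha>)) K"
    using real_moment_problem_on_points[OF assms, of "\<lambda>\<alpha>. Re (t \<alpha>)"] by blast
  obtain b where b: "\<And>d. (\<lambda>y. \<bar>b y\<bar> * poly_weight d y) summable_on K"
    "\<And>\<alpha>. ((\<lambda>y. b y * vpow y \<alpha>) has_sum Im (t \<alpha>)) K"
    using real_moment_problem_on_points[OF assms, of "\<lambda>\<alpha>. Im (t \<alpha>)"] by blast
  have "(\<lambda>y. cmod (Complex (a y) (b y)) * poly_weight d y) summable_on K" for d
  proof (rule summable_on_comparison_test[OF summable_on_add[OF a(1)[of d] b(1)[of d]]])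
    fix y
    show "cmod (Complex (a y) (b y)) * poly_weight d y \<le> \<bar>a y\<bar> * poly_weight d y + \<bar>b y\<bar> * poly_weight d y"
      unfolding distrib_right[symmetric]
      using cmod_le[of "Complex (a y) (b y)"] poly_weight_nonneg by (intro mult_right_mono) auto
  qed (simp add: poly_weight_nonneg)
  moreover have "((\<lambda>y. Complex (a y) (b y) * complex_of_real (vpow y \<alpha>)) has_sum t \<alpha>) K" for \<alpha>
  proof -
    have "((\<lambda>y. complex_of_real (a y * vpow y \<alpha>) + \<i> * complex_of_real (b y * vpow y \<alpha>))
        has_sum (complex_of_real (Re (t \<alpha>)) + \<i> * complex_of_real (Im (t \<alpha>)))) K"
      by (intro has_sum_add has_sum_cmult_right has_sum_of_real a(2) b(2))
    then show ?thesis by (simp add: Complex_eq complex_eq[symmetric] algebra_simps)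
  qed
  ultimately show ?thesis by (intro exI[of _ "\<lambda>y. Complex (a y) (b y)"]) blast
qed

text \<open>The induction carries an arbitrary monomial, because one more factor
  \<open>1 + (norm x)^2\<close> raises the exponents: it adds terms with \<alpha> increased by 2 in
  a single coordinate.\<close>

lemma integrable_poly_weight_mult:
  fixes g :: "real ^ 'n::finite \<Rightarrow> real"
  assumes "\<And>\<alpha>. integrable lebesgue (\<lambda>x. vpow x \<alpha> * g x)"
  shows "integrable lebesgue (\<lambda>x. poly_weight d x * g x)"
proof -
  have "integrable lebesgue (\<lambda>x. poly_weight d x * (vpow x \<alpha> * g x))" for \<alpha>
  proof (induction d arbitrary: \<alpha>)
    case 0
    then show ?case using assms by (simp add: poly_weight_def)
  next
    case (Suc d)
    have v: "vpow x (\<alpha> + (\<chi> j. if j = i then 2 else 0)) = vpow x \<alpha> * (x $ i)\<^sup>2" for x :: "real ^ 'n" and i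
    proof -
      have "vpow x (\<alpha> + (\<chi> j. if j = i then 2 else 0))
          = (\<Prod>j\<in>UNIV. x $ j ^ (\<alpha> $ j)) * (\<Prod>j\<in>UNIV. if j = i then (x $ j)\<^sup>2 else 1)"
        unfolding vpow_def prod.distrib[symmetric] by (rule prod.cong) (auto simp: power_add)
      then show ?thesis by (simp add: vpow_def)
    qed
    have "poly_weight (Suc d) x * (vpow x \<alpha> * g x) = poly_weight d x * (vpow x \<alpha> * g x) +
        (\<Sum>i\<in>UNIV. poly_weight d x * (vpow x (\<alpha> + (\<chi> j. if j = i then 2 else 0)) * g x))" for x
    proof -
      have "(norm x)\<^sup>2 = (\<Sum>i\<in>UNIV. (x $ i)\<^sup>2)"
        by (simp add: norm_vec_def L2_set_def sum_nonneg)
      then show ?thesis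
        by (simp add: v poly_weight_def sum_distrib_left sum_distrib_right algebra_simps)
    qed
    then show ?case
      using Suc.IH by (simp only:) (intro Bochner_Integration.integrable_add Bochner_Integration.integrable_sum)
  qed
  from this[of 0] show ?thesis by (simp add: vpow_def)
qed

section \<open>From moments on \<open>K\<close> to moments of the sum of translates\<close>

theorem theorem8:
  fixes s :: "nat ^ 'n::finite \<Rightarrow> complex"
    and g :: "real ^ 'n \<Rightarrow> real"
    and K :: "(real ^ 'n) set"
  assumes "g \<in> borel_measurable lebesgue"
    and "(\<integral>x. g x \<partial>lebesgue) \<noteq> 0"
    and "\<And>\<alpha> :: nat ^ 'n. integrable lebesgue (\<lambda>x. vpow x \<alpha> * g x)"
    and "countable K"
    and "zariski_dense K"
    and "\<And>d. finite_dim (growth_space d K)"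
  shows "\<exists>c :: real ^ 'n \<Rightarrow> complex.
    (AE x in lebesgue. (\<lambda>y. c y * complex_of_real (g (x - y))) summable_on K) \<and>
    shift_sum c K g \<in> borel_measurable lebesgue \<and>
    (\<forall>\<alpha> :: nat ^ 'n.
      integrable lebesgue (\<lambda>x. complex_of_real (vpow x \<alpha>) * shift_sum c K g x) \<and>
      s \<alpha> = (\<integral>x. complex_of_real (vpow x \<alpha>) * shift_sum c K g x \<partial>lebesgue))"
proof -
  note g_meas[measurable] = assms(1)
  define m where "m \<beta> = (\<integral>x. vpow x \<beta> * g x \<partial>lebesgue)" for \<beta> :: "nat ^ 'n"
  define b where "b \<alpha> \<beta> = (\<Prod>i\<in>UNIV. real ((\<alpha> $ i) choose (\<beta> $ i)))" for \<alpha> \<beta> :: "nat ^ 'n"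
  define A where "A \<alpha> \<beta> = b \<alpha> \<beta> * m (\<alpha> - \<beta>)" for \<alpha> \<beta>
  define D where "D \<alpha> = {\<beta> :: nat ^ 'n. \<forall>i. \<beta> $ i \<le> \<alpha> $ i}" for \<alpha>
  \<comment> \<open>On the diagonal the binomials are 1 and the moment is that of exponent 0, so the
    entry is the nonzero integral of \<open>g\<close>.\<close>
  have "complex_of_real (A \<alpha> \<alpha>) \<noteq> 0" for \<alpha>
    using assms(2) by (simp add: A_def b_def m_def vpow_def)
  from triangular_system_solvable[of "\<lambda>\<alpha> \<beta>. complex_of_real (A \<alpha> \<beta>)" s, OF this]
  \<comment> \<open>\<open>t\<close> holds the moments that the point family must have for the sum
    of translates to have moments \<open>s\<close>.\<close>
  obtain t where t: "\<And>\<alpha>. (\<Sum>\<beta>\<in>D \<alpha>. complex_of_real (A \<alpha> \<beta>) * t \<beta>) = s \<alpha>"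
    unfolding D_def by blast
  obtain c where c: "\<And>d. (\<lambda>y. cmod (c y) * poly_weight d y) summable_on K"
    "\<And>\<alpha>. ((\<lambda>y. c y * complex_of_real (vpow y \<alpha>)) has_sum t \<alpha>) K"
    using complex_moment_problem_on_points[OF assms(5,6), of t] by blast
  have vpow_meas[measurable]: "(\<lambda>x :: real ^ 'n. vpow x \<alpha>) \<in> borel_measurable lebesgue" for \<alpha>
    unfolding vpow_def by (intro borel_measurable_prod borel_measurable_power measurable_completion) simp
  have g_shift[measurable]: "(\<lambda>x. g (x - y)) \<in> borel_measurable lebesgue" for y
    using measurable_compose[OF measurable_lebesgue_translate g_meas, of "- y"] by simp
  define f where "f \<alpha> y x = complex_of_real (vpow x \<alpha>) * (c y * complex_of_real (g (x - y)))" for \<alpha> y x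
  have f_meas[measurable]: "f \<alpha> y \<in> borel_measurable lebesgue" for \<alpha> y
    unfolding f_def[abs_def] by measurable
  \<comment> \<open>Recentring at \<open>y\<close> moves the translation from \<open>g\<close> to
    the monomial, which \<open>expand\<close> then makes polynomial in \<open>y\<close>.\<close>
  have f_shift: "f \<alpha> y (y + x) = c y * complex_of_real (vpow (x + y) \<alpha> * g x)" for \<alpha> y x
    by (simp add: f_def add.commute)
  have expand: "vpow (x + y) \<alpha> * g x = (\<Sum>\<beta>\<in>D \<alpha>. b \<alpha> \<beta> * vpow y \<beta> * (vpow x (\<alpha> - \<beta>) * g x))" for x y \<alpha>
    unfolding vpow_add D_def b_def sum_distrib_right by (rule sum.cong) (simp_all add: mult_ac)
  have int_shift: "integrable lebesgue (\<lambda>x. vpow (x + y) \<alpha> * g x)" for y \<alpha>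
    unfolding expand by (intro Bochner_Integration.integrable_sum integrable_mult_right assms(3))
  have integral_shift: "(\<integral>x. vpow (x + y) \<alpha> * g x \<partial>lebesgue) = (\<Sum>\<beta>\<in>D \<alpha>. A \<alpha> \<beta> * vpow y \<beta>)" for y \<alpha>
  proof -
    have "(\<integral>x. vpow (x + y) \<alpha> * g x \<partial>lebesgue)
        = (\<Sum>\<beta>\<in>D \<alpha>. \<integral>x. b \<alpha> \<beta> * vpow y \<beta> * (vpow x (\<alpha> - \<beta>) * g x) \<partial>lebesgue)"
      unfolding expand by (intro Bochner_Integration.integral_sum integrable_mult_right assms(3))
    then show ?thesis by (simp only: integral_mult_right_zero A_def m_def) (simp only: mult_ac)
  qed
  have f_int: "integrable lebesgue (f \<alpha> y)" for \<alpha> y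
  proof -
    have "integrable lebesgue (\<lambda>x. f \<alpha> y (y + x))"
      unfolding f_shift by (intro integrable_mult_right integrable_of_real int_shift)
    then show ?thesis by (simp only: integrable_lebesgue_translate_iff[OF f_meas])
  qed
  have f_integral: "(\<integral>x. f \<alpha> y x \<partial>lebesgue) = (\<Sum>\<beta>\<in>D \<alpha>. complex_of_real (A \<alpha> \<beta>) * (c y * complex_of_real (vpow y \<beta>)))" for \<alpha> y
  proof -
    have "(\<integral>x. f \<alpha> y x \<partial>lebesgue) = (\<integral>x. f \<alpha> y (y + x) \<partial>lebesgue)"
      by (rule integral_lebesgue_translate[OF f_meas, symmetric])
    also have "\<dots> = c y * complex_of_real (\<Sum>\<beta>\<in>D \<alpha>. A \<alpha> \<beta> * vpow y \<beta>)"
      unfolding f_shift integral_mult_right_zero integral_complex_of_real integral_shift ..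
    finally show ?thesis by (simp add: sum_distrib_left mult_ac)
  qed
  \<comment> \<open>After recentring, each norm integral is at most the weight of \<open>y\<close>
    times \<open>cmod (c y)\<close> times a constant \<open>G\<close>, which is summable by the
    rapid decrease of \<open>c\<close>.\<close>
  have f_sum: "(\<lambda>y. \<integral>x. cmod (f \<alpha> y x) \<partial>lebesgue) summable_on K" for \<alpha>
  proof -
    define G where "G = (\<integral>x. poly_weight (mdeg \<alpha>) x * \<bar>g x\<bar> \<partial>lebesgue)"
    have G_int: "integrable lebesgue (\<lambda>x. poly_weight (mdeg \<alpha>) x * \<bar>g x\<bar>)"
      using integrable_abs[OF integrable_poly_weight_mult[OF assms(3), of "mdeg \<alpha>"]]
      by (simp add: abs_mult poly_weight_nonneg)
    have bound: "(\<integral>x. cmod (f \<alpha> y x) \<partial>lebesgue) \<le> cmod (c y) * poly_weight (mdeg \<alpha>) y * G" for y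
    proof -
      have "(\<integral>x. cmod (f \<alpha> y x) \<partial>lebesgue) = (\<integral>x. cmod (f \<alpha> y (y + x)) \<partial>lebesgue)"
        by (rule integral_lebesgue_translate[symmetric]) measurable
      also have "\<dots> \<le> (\<integral>x. (cmod (c y) * poly_weight (mdeg \<alpha>) y) * (poly_weight (mdeg \<alpha>) x * \<bar>g x\<bar>) \<partial>lebesgue)"
      proof (rule integral_mono)
        show "integrable lebesgue (\<lambda>x. cmod (f \<alpha> y (y + x)))"
          using f_int[of \<alpha> y] by (intro integrable_norm) (simp only: integrable_lebesgue_translate_iff[OF f_meas])
        show "integrable lebesgue (\<lambda>x. (cmod (c y) * poly_weight (mdeg \<alpha>) y) * (poly_weight (mdeg \<alpha>) x * \<bar>g x\<bar>))"
          by (intro integrable_mult_right G_int)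
        fix x
        have "cmod (f \<alpha> y (y + x)) = cmod (c y) * (\<bar>vpow (x + y) \<alpha>\<bar> * \<bar>g x\<bar>)"
          unfolding f_shift by (simp add: norm_mult)
        also have "\<dots> \<le> cmod (c y) * ((poly_weight (mdeg \<alpha>) x * poly_weight (mdeg \<alpha>) y) * \<bar>g x\<bar>)"
          by (intro mult_left_mono mult_right_mono abs_vpow_add_le) auto
        finally show "cmod (f \<alpha> y (y + x)) \<le> (cmod (c y) * poly_weight (mdeg \<alpha>) y) * (poly_weight (mdeg \<alpha>) x * \<bar>g x\<bar>)"
          by (simp add: mult_ac)
      qed
      finally show ?thesis by (simp add: G_def)
    qed
    show ?thesis
      by (rule summable_on_comparison_test[OF summable_on_cmult_left[OF c(1)[of "mdeg \<alpha>"], of G]])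
         (use bound in auto)
  qed
  have shift_sum: "(\<Sum>\<^sub>\<infinity>y\<in>K. f \<alpha> y x) = complex_of_real (vpow x \<alpha>) * shift_sum c K g x" for \<alpha> x
    unfolding f_def shift_sum_def by (rule infsum_cmult_right')
  have main: "integrable lebesgue (\<lambda>x. complex_of_real (vpow x \<alpha>) * shift_sum c K g x) \<and>
      s \<alpha> = (\<integral>x. complex_of_real (vpow x \<alpha>) * shift_sum c K g x \<partial>lebesgue)" for \<alpha>
  proof -
    obtain F where F: "integrable lebesgue F"
      "AE x in lebesgue. F x = complex_of_real (vpow x \<alpha>) * shift_sum c K g x"
      "((\<lambda>y. \<integral>x. f \<alpha> y x \<partial>lebesgue) has_sum (\<integral>x. F x \<partial>lebesgue)) K"
      using integral_infsum_countable(2)[OF assms(4) f_int f_sum, of \<alpha>] unfolding shift_sum by blast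
    \<comment> \<open>Lebesgue measure is complete, so measurability passes from \<open>F\<close> to
      a function equal to it almost everywhere.\<close>
    have meas: "(\<lambda>x. complex_of_real (vpow x \<alpha>) * shift_sum c K g x) \<in> borel_measurable lebesgue"
      by (rule borel_measurable_AE[OF borel_measurable_integrable[OF F(1)] F(2)])
    \<comment> \<open>Each integral is a finite combination of terms
      \<open>c y * vpow y \<beta>\<close>, so summing over \<open>K\<close> replaces these by
      \<open>t \<beta>\<close> and yields row \<alpha> of the triangular system.\<close>
    have "((\<lambda>y. \<integral>x. f \<alpha> y x \<partial>lebesgue) has_sum (\<Sum>\<beta>\<in>D \<alpha>. complex_of_real (A \<alpha> \<beta>) * t \<beta>)) K"
      unfolding f_integral by (intro has_sum_sum has_sum_cmult_right c(2))
    then have "s \<alpha> = (\<integral>x. F x \<partial>lebesgue)"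
      using has_sum_unique[OF F(3)] t[of \<alpha>] by simp
    also have "\<dots> = (\<integral>x. complex_of_real (vpow x \<alpha>) * shift_sum c K g x \<partial>lebesgue)"
      using F(1) meas F(2) by (intro integral_cong_AE) auto
    finally show ?thesis
      using integrable_cong_AE_imp[OF F(1) meas] F(2) by auto
  qed
  have one: "vpow x 0 = 1" for x :: "real ^ 'n" by (simp add: vpow_def)
  \<comment> \<open>The case \<alpha> = 0 already contains measurability of the sum itself.\<close>
  have "shift_sum c K g \<in> borel_measurable lebesgue"
    using borel_measurable_integrable[OF conjunct1[OF main[of 0]]] by (simp add: one)
  moreover have "AE x in lebesgue. (\<lambda>y. c y * complex_of_real (g (x - y))) summable_on K"
    using integral_infsum_countable(1)[OF assms(4) f_int f_sum, of 0]
    by (rule AE_mp) (auto intro!: abs_summable_summable simp: f_def one)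
  ultimately show ?thesis using main by blast
qed

end
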